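(* Let $t\in(\mathbb{R}^2)^N$. If $g_j\neq 0$ for at least one $j\in\{1,\ldots,N\}$, then the functional $L^2(A,\mathbb{C})\to\mathbb{R}$, $\Psi\mapsto E[\Psi,t]$, is not convex.
   Context: A superscript $*$ denotes complex conjugation, and $(\mathcal{F}h)(x)=\int h(y)e^{-2\pi i x\cdot y}\,\mathrm{d}y$ is the Fourier transform. Fix constants $\lambda>0$, $C_s\in\mathbb{R}$, $\alpha_{\max}>0$. Let $s\in L^1(\mathbb{R}^2,\mathbb{R})$ and $f\in L^1(\mathbb{R},\mathbb{R})$ be probability density functions. For $z\in\mathbb{R}$, $v\in\mathbb{R}^2$ (Euclidean norm $|v|$) put $\chi_z(v):=\frac12 z\lambda|v|^2+\frac14 C_s\lambda^3|v|^4$ and $p_z(v):=\exp(-2\pi i\chi_z(v))$. Let $A:=\{v\in\mathbb{R}^2:|v|<\alpha_{\max}/\lambda\}$ and let $a$ be the indicator function of $A$. For $Z\in\mathbb{R}$ let $$T_Z(v,w):=a(v)a^*(w)\int_{\mathbb{R}}\int_{\mathbb{R}^2}s(u)f(Z')\,p_{Z+Z'}(v+u)\,p_{Z+Z'}^*(w+u)\,\mathrm{d}u\,\mathrm{d}Z',\quad v,w\in\mathbb{R}^2.$$ The weighted cross-correlation of $\Psi,\Phi$ with weight $T$ is $(\Psi\star_{T}\Phi)(x):=\int_{\mathbb{R}^2}\Psi^*(y)\Phi(x+y)T(x+y,y)\,\mathrm{d}y$; functions in $L^2(A,\mathbb{C})$ are extended by zero to $\mathbb{R}^2$. Let $N\in\mathbb{N}$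 and let $g_1,\ldots,g_N\in L^1(\mathbb{R}^2,\mathbb{R}_{\ge0})\cap L^2(\mathbb{R}^2,\mathbb{R}_{\ge0})$ satisfy $\operatorname{supp}(\mathcal{F}(g_j))\subseteq\overline{2A}$ for all $j$; let $Z_1,\ldots,Z_N\in\mathbb{R}$. With $\phi_y(x):=x+y$, define $$E:L^2(A,\mathbb{C})\times(\mathbb{R}^2)^N\to\mathbb{R},\quad E[\Psi,t]:=\frac1N\sum_{j=1}^N\big\|\Psi\star_{T_{Z_j}}\Psi-\mathcal{F}(g_j\circ\phi_{t_j})\big\|_{L^2}^2 .$$ *)

theory Defs
  imports "HOL-Analysis.Analysis" "HOL-Library.Function_Algebras"
begin

text \<open>
  Functions into a real vector space form a real vector space under the pointwise operations
  (\<^theory>\<open>HOL-Library.Function_Algebras\<close> stops at the additive and ring structure), so that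
  \<^const>\<open>convex_on\<close> applies to functionals on a space of functions.
\<close>

instantiation "fun" :: (type, real_vector) real_vector
begin

definition "r *\<^sub>R f = (\<lambda>x. r *\<^sub>R f x)"

instance
  by standard
     (simp_all add: scaleR_fun_def plus_fun_def scaleR_add_right scaleR_add_left)

end

lemma scaleR_fun_apply [simp]: "(r *\<^sub>R f) x = r *\<^sub>R f x"
  by (simp add: scaleR_fun_def)

definition fourier :: "('a::euclidean_space \<Rightarrow> complex) \<Rightarrow> 'a \<Rightarrow> complex" where
  "fourier h x = (\<integral>y. h y * exp (- (2 * pi * \<i> * complex_of_real (x \<bullet> y))) \<partial>lborel)"

definition supp :: "('a::topological_space \<Rightarrow> 'b::zero) \<Rightarrow> 'a set" where
  "supp h = closure {x. h x \<noteq> 0}"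

text \<open>
  Elements of $L^1$ and $L^2$ are represented by Borel functions, and properties of them are
  required almost everywhere.
\<close>

definition prob_density :: "('a::euclidean_space \<Rightarrow> real) \<Rightarrow> bool" where
  "prob_density h \<longleftrightarrow>
     integrable lborel h \<and> (AE x in lborel. 0 \<le> h x) \<and> (\<integral>x. h x \<partial>lborel) = 1"

text \<open>
  The representatives of $L^2(A,C)$, already extended by zero to the whole space. Two of them that
  agree almost everywhere are not identified; the functional \<open>E\<close> below is built from
  Lebesgue integrals only and takes the same value on both.
\<close>

definition L2_on :: "'a::euclidean_space set \<Rightarrow> ('a \<Rightarrow> complex) set" where
  "L2_on A = {\<Psi>. \<Psi> \<in> borel_measurable lborel \<and>
                  integrable lborel (\<lambda>v. (cmod (\<Psi> v))\<^sup>2) \<and> (\<forall>v. v \<notin> A \<longrightarrow> \<Psi> v = 0)}"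

text \<open>Since \<^const>\<open>convex_on\<close> includes convexity of the domain, its negation is meaningful only
  together with this fact.\<close>

lemma convex_L2_on: "convex (L2_on A)"
proof (rule convexI)
  fix \<Psi> \<Phi> :: "'a \<Rightarrow> complex" and u v :: real
  assume *: "\<Psi> \<in> L2_on A" "\<Phi> \<in> L2_on A"
  have meas [measurable]: "\<Psi> \<in> borel_measurable borel" "\<Phi> \<in> borel_measurable borel"
    using * by (auto simp: L2_on_def)
  have "integrable lborel (\<lambda>x. (cmod (u *\<^sub>R \<Psi> x + v *\<^sub>R \<Phi> x))\<^sup>2)"
  proof (rule Bochner_Integration.integrable_bound)
    show "integrable lborel
            (\<lambda>x. 2 * u\<^sup>2 * (cmod (\<Psi> x))\<^sup>2 + 2 * v\<^sup>2 * (cmod (\<Phi> x))\<^sup>2)"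
      using * by (auto simp: L2_on_def)
    show "AE x in lborel. norm ((cmod (u *\<^sub>R \<Psi> x + v *\<^sub>R \<Phi> x))\<^sup>2)
            \<le> norm (2 * u\<^sup>2 * (cmod (\<Psi> x))\<^sup>2 + 2 * v\<^sup>2 * (cmod (\<Phi> x))\<^sup>2)"
    proof (rule AE_I2)
      fix x
      have "(cmod (u *\<^sub>R \<Psi> x + v *\<^sub>R \<Phi> x))\<^sup>2
              \<le> (cmod (u *\<^sub>R \<Psi> x) + cmod (v *\<^sub>R \<Phi> x))\<^sup>2"
        by (intro power_mono norm_triangle_ineq) simp
      also have "\<dots> \<le> 2 * (cmod (u *\<^sub>R \<Psi> x))\<^sup>2 + 2 * (cmod (v *\<^sub>R \<Phi> x))\<^sup>2"
        using sum_squares_bound[of "cmod (u *\<^sub>R \<Psi> x)" "cmod (v *\<^sub>R \<Phi> x)"]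
        by (simp add: power2_sum)
      finally show "norm ((cmod (u *\<^sub>R \<Psi> x + v *\<^sub>R \<Phi> x))\<^sup>2)
          \<le> norm (2 * u\<^sup>2 * (cmod (\<Psi> x))\<^sup>2 + 2 * v\<^sup>2 * (cmod (\<Phi> x))\<^sup>2)"
        by (simp add: power_mult_distrib)
    qed
  qed measurable
  then show "u *\<^sub>R \<Psi> + v *\<^sub>R \<Phi> \<in> L2_on A"
    using * by (simp add: L2_on_def plus_fun_def scaleR_fun_def)
qed

definition L2_norm :: "('a::euclidean_space \<Rightarrow> complex) \<Rightarrow> real" where
  "L2_norm h = sqrt (\<integral>x. (cmod (h x))\<^sup>2 \<partial>lborel)"

definition aberration :: "real \<Rightarrow> real \<Rightarrow> real \<Rightarrow> real^2 \<Rightarrow> real" where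
  "aberration lam Cs z v = 1/2 * z * lam * (norm v)\<^sup>2 + 1/4 * Cs * lam^3 * (norm v)^4"

definition phase :: "real \<Rightarrow> real \<Rightarrow> real \<Rightarrow> real^2 \<Rightarrow> complex" where
  "phase lam Cs z v = exp (- (2 * pi * \<i> * complex_of_real (aberration lam Cs z v)))"

definition aperture :: "real \<Rightarrow> real \<Rightarrow> (real^2) set" where
  "aperture lam \<alpha>max = {v. norm v < \<alpha>max / lam}"

definition TCC :: "real \<Rightarrow> real \<Rightarrow> real \<Rightarrow> (real^2 \<Rightarrow> real) \<Rightarrow> (real \<Rightarrow> real) \<Rightarrow>
    real \<Rightarrow> real^2 \<Rightarrow> real^2 \<Rightarrow> complex" where
  "TCC lam Cs \<alpha>max s f Z v w =
     indicator (aperture lam \<alpha>max) v * cnj (indicator (aperture lam \<alpha>max) w) *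
     (\<integral>Z'. (\<integral>u. complex_of_real (s u) * complex_of_real (f Z') *
              phase lam Cs (Z + Z') (v + u) * cnj (phase lam Cs (Z + Z') (w + u)) \<partial>lborel) \<partial>lborel)"

definition cross_corr :: "(real^2 \<Rightarrow> real^2 \<Rightarrow> complex) \<Rightarrow>
    (real^2 \<Rightarrow> complex) \<Rightarrow> (real^2 \<Rightarrow> complex) \<Rightarrow> real^2 \<Rightarrow> complex" where
  "cross_corr T \<Psi> \<Phi> x = (\<integral>y. cnj (\<Psi> y) * \<Phi> (x + y) * T (x + y) y \<partial>lborel)"

text \<open>
  Families indexed by $1,\dots,N$ are functions on \<^typ>\<open>nat\<close> whose values outside
  \<^term>\<open>{1..N}\<close> are irrelevant.
\<close>

definition E :: "real \<Rightarrow> real \<Rightarrow> real \<Rightarrow> (real^2 \<Rightarrow> real) \<Rightarrow> (real \<Rightarrow> real) \<Rightarrow>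
    nat \<Rightarrow> (nat \<Rightarrow> real^2 \<Rightarrow> real) \<Rightarrow> (nat \<Rightarrow> real) \<Rightarrow>
    (real^2 \<Rightarrow> complex) \<Rightarrow> (nat \<Rightarrow> real^2) \<Rightarrow> real" where
  "E lam Cs \<alpha>max s f N g Z \<Psi> t =
     1 / real N * (\<Sum>j=1..N.
       (L2_norm (\<lambda>x. cross_corr (TCC lam Cs \<alpha>max s f (Z j)) \<Psi> \<Psi> x
                     - fourier (\<lambda>y. complex_of_real ((g j \<circ> (\<lambda>x. x + t j)) y)) x))\<^sup>2)"

end

theory Submission
  imports Defs
begin

text \<open>
  Write \<open>Q\<^sub>j(\<Psi>)\<close> for the weighted autocorrelation of \<open>\<Psi>\<close> and \<open>G\<^sub>j\<close> for the Fourier transform of the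
  shifted \<open>g\<^sub>j\<close>. Since \<open>Q\<^sub>j\<close> is quadratic, on a real line through the origin the functional is an even
  quartic: \<open>N E[r\<Psi>] = r^4 a - 2 r^2 b + c\<close> with \<open>a = \<Sum>\<^sub>j \<parallel>Q\<^sub>j(\<Psi>)\<parallel>^2\<close> and
  \<open>b = \<Sum>\<^sub>j Re \<langle>Q\<^sub>j(\<Psi>), G\<^sub>j\<rangle>\<close>. If \<open>b > 0\<close>, then for small \<open>r > 0\<close> both \<open>E[r\<Psi>]\<close> and \<open>E[-r\<Psi>]\<close> lie strictly
  below \<open>E[0]\<close>, so the value at the midpoint contradicts convexity
  (\<open>not_convex_on_if_center_max\<close>).

  It remains to find \<open>\<Psi>\<close> with \<open>b > 0\<close>. Unfolding the autocorrelation,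
  \<open>\<langle>Q\<^sub>j(\<Psi>), G\<^sub>j\<rangle>\<close> is the double integral of \<open>\<Psi>(v) \<Psi>(w)\<^sup>* T\<^sub>j(v,w) G\<^sub>j(v - w)\<^sup>*\<close>. The kernel
  \<open>T\<^sub>j(v,w) G\<^sub>j(v - w)\<^sup>*\<close> is continuous near the origin (\<open>continuous_on_tcc_kernel\<close>,
  \<open>continuous_on_fourier\<close>). At the origin \<open>T\<^sub>j\<close> is \<open>1\<close>, because there the phases cancel and \<open>s\<close> and \<open>f\<close>
  have mass one (\<open>tcc_kernel_diagonal\<close>), and \<open>G\<^sub>j(0)\<close> is the integral of \<open>g\<^sub>j\<close>, which is positive unless
  \<open>g\<^sub>j = 0\<close> almost everywhere. So the real part of the kernel is positive on a neighbourhood of the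
  origin, which can be chosen for all nonzero \<open>g\<^sub>j\<close> at once, and the indicator function of a small
  ball does the job (\<open>cross_corr_inner_pos\<close>). The terms with \<open>g\<^sub>j = 0\<close> contribute nothing to \<open>b\<close>.

  The expansion of \<open>E\<close> needs \<open>G\<^sub>j\<close> to be square integrable. This follows from the support condition:
  \<open>G\<^sub>j\<close> is continuous, bounded and vanishes outside a bounded set.
\<close>

section \<open>Integrals depending on a parameter\<close>

lemma continuous_on_integral_dominated:
  fixes F :: "'a::metric_space \<Rightarrow> 'b \<Rightarrow> 'c::{banach,second_countable_topology}"
  assumes meas: "\<And>p. F p \<in> borel_measurable M"
    and cont: "\<And>x. continuous_on UNIV (\<lambda>p. F p x)"
    and dom: "integrable M w" "\<And>p x. norm (F p x) \<le> w x"
  shows "continuous_on UNIV (\<lambda>p. \<integral>x. F p x \<partial>M)"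
proof -
  have "isCont (\<lambda>p. \<integral>x. F p x \<partial>M) a" for a
    unfolding continuous_at_sequentially o_def
  proof (intro allI impI)
    fix p :: "nat \<Rightarrow> 'a" assume p: "p \<longlonglongrightarrow> a"
    show "(\<lambda>n. \<integral>x. F (p n) x \<partial>M) \<longlonglongrightarrow> (\<integral>x. F a x \<partial>M)"
    proof (rule integral_dominated_convergence[where w = w])
      show "AE x in M. (\<lambda>n. F (p n) x) \<longlonglongrightarrow> F a x"
        using continuous_on_tendsto_compose[OF cont p] by simp
    qed (use assms in auto)
  qed
  then show ?thesis
    by (simp add: continuous_at_imp_continuous_on)
qed

lemma borel_measurable_cnj [measurable (raw)]:
  "h \<in> borel_measurable M \<Longrightarrow> (\<lambda>x. cnj (h x)) \<in> borel_measurable M"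
  by (rule borel_measurable_continuous_on[OF continuous_on_cnj[OF continuous_on_id]])

lemma integral_lborel_pos_if_pos_on_open:
  fixes h :: "'a::euclidean_space \<Rightarrow> real"
  assumes "integrable lborel h" and nonneg: "\<And>x. 0 \<le> h x"
    and "open U" "U \<noteq> {}" and pos: "\<And>x. x \<in> U \<Longrightarrow> 0 < h x"
  shows "0 < (\<integral>x. h x \<partial>lborel)"
proof (rule ccontr)
  assume "\<not> 0 < (\<integral>x. h x \<partial>lborel)"
  moreover have "0 \<le> (\<integral>x. h x \<partial>lborel)"
    using nonneg by (intro Bochner_Integration.integral_nonneg)
  ultimately have "(\<integral>x. h x \<partial>lborel) = 0"
    by simp
  then have "AE x in lborel. h x = 0"
    using assms by (subst (asm) integral_nonneg_eq_0_iff_AE) auto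
  then have "AE x in lborel. x \<notin> U"
    by eventually_elim (use pos in force)
  then have "U \<in> null_sets lborel"
    using \<open>open U\<close> by (subst (asm) AE_iff_null_sets[symmetric]) auto
  then show False
    using open_not_negligible[OF \<open>open U\<close> \<open>U \<noteq> {}\<close>] null_sets_completionI[of U lborel]
    unfolding negligible_iff_null_sets by blast
qed

text \<open>
  Every integrability claim about autocorrelations and about the \<open>G\<^sub>j\<close> is reduced to this criterion.
\<close>

lemma integrable_lborel_bounded_support:
  fixes h :: "'a::euclidean_space \<Rightarrow> 'b::{banach,second_countable_topology}"
  assumes "h \<in> borel_measurable borel" and bound: "\<And>x. norm (h x) \<le> C"
    and S: "bounded S" "\<And>x. x \<notin> S \<Longrightarrow> h x = 0"
  shows "integrable lborel h"
proof -
  obtain R where R: "S \<subseteq> cball 0 R"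
    using S(1) by (auto simp: bounded_iff subset_iff)
  show ?thesis
  proof (rule Bochner_Integration.integrable_bound)
    show "integrable lborel (\<lambda>x :: 'a. C * indicator (cball 0 R) x :: real)"
      using emeasure_lborel_cball_finite[of "0 :: 'a" R]
      by (intro integrable_mult_right integrable_real_indicator) simp_all
    have "norm (h x) \<le> norm (C * indicator (cball 0 R) x :: real)" for x
    proof (cases "x \<in> S")
      case True
      then have "x \<in> cball 0 R" using R by blast
      then show ?thesis using bound[of x] by simp
    next
      case False
      then show ?thesis by (simp add: S(2))
    qed
    then show "AE x in lborel. norm (h x) \<le> norm (C * indicator (cball 0 R) x :: real)"
      by (rule AE_I2)
    show "h \<in> borel_measurable lborel"
      using assms(1) by simp
  qed
qed

section \<open>The Fourier transform of an integrable function\<close>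

lemma norm_fourier_phase: "cmod (exp (- (2 * pi * \<i> * complex_of_real r))) = 1"
  by (simp add: norm_exp_eq_Re)

lemma continuous_on_fourier:
  assumes "integrable lborel h"
  shows "continuous_on UNIV (fourier h)"
proof -
  have [measurable]: "h \<in> borel_measurable borel"
    using assms by auto
  show ?thesis
    unfolding fourier_def
    by (rule continuous_on_integral_dominated[where w = "\<lambda>y. cmod (h y)"])
       (use assms in \<open>auto simp: norm_mult norm_fourier_phase intro!: continuous_intros\<close>)
qed

lemma norm_fourier_le:
  assumes "integrable lborel h"
  shows "cmod (fourier h x) \<le> (\<integral>y. cmod (h y) \<partial>lborel)"
proof -
  have "cmod (fourier h x) \<le> (\<integral>y. cmod (h y * exp (- (2 * pi * \<i> * complex_of_real (x \<bullet> y)))) \<partial>lborel)"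
    unfolding fourier_def by (rule integral_norm_bound)
  then show ?thesis
    by (simp add: norm_mult norm_fourier_phase)
qed

lemma integrable_lborel_shift:
  fixes h :: "'a::euclidean_space \<Rightarrow> 'b::{banach,second_countable_topology}"
  assumes "integrable lborel h"
  shows "integrable lborel (h \<circ> (\<lambda>x. x + t))"
proof -
  have "integrable (distr lborel borel ((+) t)) h"
    using assms by (simp add: lborel_distr_plus)
  then show ?thesis
    using assms by (subst (asm) integrable_distr_eq) (auto simp: o_def add.commute)
qed

text \<open>
  Shifting only multiplies the transform by a unimodular factor, so the support condition on the
  transform of \<open>g\<^sub>j\<close> carries over to the shifted image.
\<close>

lemma fourier_shift:
  assumes "integrable lborel h"
  shows "fourier (h \<circ> (\<lambda>x. x + t)) x = exp (2 * pi * \<i> * complex_of_real (x \<bullet> t)) * fourier h x"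
proof -
  have [measurable]: "h \<in> borel_measurable borel"
    using assms by auto
  let ?e = "\<lambda>y. exp (- (2 * pi * \<i> * complex_of_real (x \<bullet> y)))"
  have "exp (2 * pi * \<i> * complex_of_real (x \<bullet> t)) * fourier h x
      = exp (2 * pi * \<i> * complex_of_real (x \<bullet> t)) *
          (\<integral>y. h y * ?e y \<partial>distr lborel borel ((+) t))"
    by (simp add: lborel_distr_plus fourier_def)
  also have "(\<integral>y. h y * ?e y \<partial>distr lborel borel ((+) t)) = (\<integral>y. h (t + y) * ?e (t + y) \<partial>lborel)"
    by (rule integral_distr) measurable
  also have "exp (2 * pi * \<i> * complex_of_real (x \<bullet> t)) * (\<integral>y. h (t + y) * ?e (t + y) \<partial>lborel)
     = (\<integral>y. exp (2 * pi * \<i> * complex_of_real (x \<bullet> t)) * (h (t + y) * ?e (t + y)) \<partial>lborel)"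
    by simp
  also have "\<dots> = fourier (h \<circ> (\<lambda>x. x + t)) x"
    unfolding fourier_def o_def
    by (intro Bochner_Integration.integral_cong)
       (simp_all add: inner_add_right algebra_simps flip: exp_add)
  finally show ?thesis ..
qed

section \<open>The transmission cross-coefficient\<close>

text \<open>
  The cross-coefficient without the cut-off by the aperture. Unlike the cross-coefficient itself
  it is continuous on the whole space.
\<close>

definition tcc_kernel :: "real \<Rightarrow> real \<Rightarrow> (real^2 \<Rightarrow> real) \<Rightarrow> (real \<Rightarrow> real) \<Rightarrow>
    real \<Rightarrow> real^2 \<Rightarrow> real^2 \<Rightarrow> complex" where
  "tcc_kernel lam Cs s f Z v w =
     (\<integral>Z'. (\<integral>u. complex_of_real (s u) * complex_of_real (f Z') *
        phase lam Cs (Z + Z') (v + u) * cnj (phase lam Cs (Z + Z') (w + u)) \<partial>lborel) \<partial>lborel)"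

lemma TCC_eq_tcc_kernel:
  "TCC lam Cs \<alpha>max s f Z v w =
     indicator (aperture lam \<alpha>max) v * indicator (aperture lam \<alpha>max) w * tcc_kernel lam Cs s f Z v w"
  by (simp add: TCC_def tcc_kernel_def indicator_def)

lemma cmod_phase [simp]: "cmod (phase lam Cs z v) = 1"
  unfolding phase_def by (rule norm_fourier_phase)

lemma cmod_tcc_integrand:
  "cmod (complex_of_real (s u) * complex_of_real (f Z') *
     phase lam Cs z v * cnj (phase lam Cs z w)) = \<bar>s u\<bar> * \<bar>f Z'\<bar>"
  by (simp add: norm_mult)

lemma continuous_on_phase [continuous_intros]:
  assumes "continuous_on S h"
  shows "continuous_on S (\<lambda>p. phase lam Cs z (h p))"
  unfolding phase_def aberration_def by (intro continuous_intros assms)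

lemma measurable_phase [measurable]:
  assumes [measurable]: "z \<in> borel_measurable M" "h \<in> borel_measurable M"
  shows "(\<lambda>p. phase lam Cs (z p) (h p)) \<in> borel_measurable M"
  unfolding phase_def aberration_def by measurable

lemma cmod_tcc_inner_le:
  assumes "integrable lborel s"
  shows "cmod (\<integral>u. complex_of_real (s u) * complex_of_real (f Z') *
           phase lam Cs z (v + u) * cnj (phase lam Cs z (w + u)) \<partial>lborel)
         \<le> (\<integral>u. \<bar>s u\<bar> \<partial>lborel) * \<bar>f Z'\<bar>"
  by (rule order_trans[OF integral_norm_bound]) (simp add: norm_mult)

lemma cmod_tcc_kernel_le:
  assumes "integrable lborel s" "integrable lborel f"
  shows "cmod (tcc_kernel lam Cs s f Z v w) \<le> (\<integral>u. \<bar>s u\<bar> \<partial>lborel) * (\<integral>Z'. \<bar>f Z'\<bar> \<partial>lborel)"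
proof -
  have "cmod (tcc_kernel lam Cs s f Z v w) \<le> (\<integral>Z'. (\<integral>u. \<bar>s u\<bar> \<partial>lborel) * \<bar>f Z'\<bar> \<partial>lborel)"
    unfolding tcc_kernel_def
    by (rule order_trans[OF integral_norm_bound], rule integral_mono_AE')
       (use assms in \<open>auto intro!: cmod_tcc_inner_le\<close>)
  then show ?thesis by simp
qed

text \<open>
  All phase factors are unimodular, so \<open>\<bar>s u\<bar> \<bar>f Z'\<bar>\<close> dominates the integrand for every \<open>(v, w)\<close>.
  Dominated convergence is applied to the inner integral first, then to the outer one.
\<close>

lemma continuous_on_tcc_kernel:
  assumes s: "integrable lborel s" and f: "integrable lborel f"
  shows "continuous_on UNIV (\<lambda>(v, w). tcc_kernel lam Cs s f Z v w)"
proof -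
  have [measurable]: "s \<in> borel_measurable borel" "f \<in> borel_measurable borel"
    using assms by auto
  let ?I = "\<lambda>p Z' u. complex_of_real (s u) * complex_of_real (f Z') *
    phase lam Cs (Z + Z') (fst p + u) * cnj (phase lam Cs (Z + Z') (snd p + u))"
  have "continuous_on UNIV (\<lambda>p. \<integral>u. ?I p Z' u \<partial>lborel)" for Z'
    by (rule continuous_on_integral_dominated[where w = "\<lambda>u. \<bar>s u\<bar> * \<bar>f Z'\<bar>"])
       (use s in \<open>auto simp: cmod_tcc_integrand intro!: continuous_intros\<close>)
  then have "continuous_on UNIV (\<lambda>p. \<integral>Z'. (\<integral>u. ?I p Z' u \<partial>lborel) \<partial>lborel)"
    by (intro continuous_on_integral_dominated[where w = "\<lambda>Z'. (\<integral>u. \<bar>s u\<bar> \<partial>lborel) * \<bar>f Z'\<bar>"])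
       (use s f in \<open>auto intro!: cmod_tcc_inner_le\<close>)
  then show ?thesis
    by (simp add: tcc_kernel_def case_prod_beta)
qed

text \<open>On the diagonal the two phase factors cancel and only the total masses remain.\<close>

lemma tcc_kernel_diagonal:
  assumes "prob_density s" "prob_density f"
  shows "tcc_kernel lam Cs s f Z v v = 1"
proof -
  have "phase lam Cs z x * cnj (phase lam Cs z x) = 1" for z x
    using complex_norm_square[of "phase lam Cs z x"] by simp
  then show ?thesis
    using assms unfolding tcc_kernel_def
    by (simp add: mult.assoc prob_density_def flip: of_real_mult)
qed

section \<open>Weighted cross-correlations\<close>

lemma cross_corr_scaleR:
  "cross_corr T (r *\<^sub>R \<Psi>) (r *\<^sub>R \<Psi>) x = complex_of_real (r\<^sup>2) * cross_corr T \<Psi> \<Psi> x"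
proof -
  have "cross_corr T (r *\<^sub>R \<Psi>) (r *\<^sub>R \<Psi>) x
      = (\<integral>y. complex_of_real (r\<^sup>2) * (cnj (\<Psi> y) * \<Psi> (x + y) * T (x + y) y) \<partial>lborel)"
    unfolding cross_corr_def
    by (intro Bochner_Integration.integral_cong) (simp_all add: scaleR_conv_of_real power2_eq_square)
  then show ?thesis by (simp add: cross_corr_def)
qed

lemma cmod_diff_square:
  "(cmod (complex_of_real c * z - w))\<^sup>2 = c\<^sup>2 * (cmod z)\<^sup>2 - 2 * c * Re (z * cnj w) + (cmod w)\<^sup>2"
  unfolding cmod_power2 by (simp add: power2_eq_square algebra_simps)

lemma L2_norm_diff_square:
  fixes Q G :: "'a::euclidean_space \<Rightarrow> complex"
  assumes "integrable lborel (\<lambda>x. (cmod (Q x))\<^sup>2)" "integrable lborel (\<lambda>x. (cmod (G x))\<^sup>2)"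
    and "integrable lborel (\<lambda>x. Re (Q x * cnj (G x)))"
  shows "(L2_norm (\<lambda>x. complex_of_real c * Q x - G x))\<^sup>2
    = c\<^sup>2 * (L2_norm Q)\<^sup>2 - 2 * c * (\<integral>x. Re (Q x * cnj (G x)) \<partial>lborel) + (L2_norm G)\<^sup>2"
proof -
  have "(L2_norm h)\<^sup>2 = (\<integral>x. (cmod (h x))\<^sup>2 \<partial>lborel)" for h :: "'a \<Rightarrow> complex"
    by (simp add: L2_norm_def)
  then show ?thesis
    using assms by (simp add: cmod_diff_square del: times_complex.sel)
qed

text \<open>
  The autocorrelation of the indicator function of a small ball, for an arbitrary bounded measurable
  weight: these two properties make all integrals below exist.
\<close>

locale bump_correlation =
  fixes T :: "real^2 \<Rightarrow> real^2 \<Rightarrow> complex" and C \<epsilon> :: real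
  assumes measurable_weight: "(\<lambda>(v, w). T v w) \<in> borel_measurable borel"
    and weight_bounded: "\<And>v w. cmod (T v w) \<le> C"
    and radius_pos: "\<epsilon> > 0"
begin

abbreviation bump :: "real^2 \<Rightarrow> complex" where
  "bump \<equiv> indicator (ball 0 \<epsilon>)"

lemma measurable_weight' [measurable (raw)]:
  assumes [measurable]: "h \<in> M \<rightarrow>\<^sub>M borel" "k \<in> M \<rightarrow>\<^sub>M borel"
  shows "(\<lambda>x. T (h x) (k x)) \<in> borel_measurable M"
proof -
  have "(\<lambda>x. (h x, k x)) \<in> M \<rightarrow>\<^sub>M borel"
    by measurable
  from measurable_compose[OF this measurable_weight] show ?thesis by simp
qed

lemma measurable_bump [measurable]: "bump \<in> borel_measurable borel"
  by (rule borel_measurable_indicator) simp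

lemma weight_bound_nonneg: "0 \<le> C"
  using order_trans[OF norm_ge_zero weight_bounded[of 0 0]] .

lemma measurable_integrand [measurable]:
  "(\<lambda>(x, y). cnj (bump y) * bump (x + y) * T (x + y) y) \<in> borel_measurable (borel \<Otimes>\<^sub>M borel)"
  by measurable

lemma integrable_integrand: "integrable lborel (\<lambda>y. cnj (bump y) * bump (x + y) * T (x + y) y)"
proof (rule integrable_lborel_bounded_support[where C = C and S = "ball 0 \<epsilon>"])
  show "norm (cnj (bump y) * bump (x + y) * T (x + y) y) \<le> C" for y
    using weight_bounded[of "x + y" y] weight_bound_nonneg
    by (auto simp: indicator_def norm_mult)
  show "(\<lambda>y. cnj (bump y) * bump (x + y) * T (x + y) y) \<in> borel_measurable borel"
    using measurable_compose_Pair1[OF _ measurable_integrand, of x] by simp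
  show "cnj (bump y) * bump (x + y) * T (x + y) y = 0" if "y \<notin> ball 0 \<epsilon>" for y
    unfolding indicator_simps(2)[OF that] by simp
qed (rule bounded_ball)

lemma measurable_cross_corr [measurable]: "cross_corr T bump bump \<in> borel_measurable borel"
proof -
  have "(\<lambda>x. \<integral>y. cnj (bump y) * bump (x + y) * T (x + y) y \<partial>lborel) \<in> borel_measurable borel"
    by (rule lborel.borel_measurable_lebesgue_integral) measurable
  then show ?thesis by (simp add: cross_corr_def[abs_def])
qed

lemma cross_corr_bounded: "\<exists>M. \<forall>x. cmod (cross_corr T bump bump x) \<le> M"
proof (intro exI allI)
  fix x
  have "cmod (cross_corr T bump bump x) \<le> (\<integral>y. C * indicator (ball 0 \<epsilon>) (y :: real^2) \<partial>lborel)"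
    unfolding cross_corr_def
  proof (rule Bochner_Integration.integral_norm_bound_integral)
    show "integrable lborel (\<lambda>y. C * indicator (ball 0 \<epsilon>) (y :: real^2))"
      using emeasure_lborel_ball_finite[of "0 :: real^2" \<epsilon>]
      by (intro integrable_mult_right integrable_real_indicator) simp_all
    show "cmod (cnj (bump y) * bump (x + y) * T (x + y) y) \<le> C * indicator (ball 0 \<epsilon>) y" for y
      using weight_bounded[of "x + y" y] weight_bound_nonneg
      by (auto simp: indicator_def norm_mult)
  qed (rule integrable_integrand)
  then show "cmod (cross_corr T bump bump x) \<le> (\<integral>y. C * indicator (ball 0 \<epsilon>) (y :: real^2) \<partial>lborel)" .
qed

lemma cross_corr_eq_0:
  assumes "x \<notin> ball 0 (2 * \<epsilon>)"
  shows "cross_corr T bump bump x = 0"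
proof -
  have vanish: "cnj (bump y) * bump (x + y) * T (x + y) y = 0" for y
  proof -
    have "\<not> (norm y < \<epsilon> \<and> norm (x + y) < \<epsilon>)"
      using assms norm_triangle_ineq4[of "x + y" y] by auto
    then show ?thesis by (auto simp: indicator_def)
  qed
  show ?thesis unfolding cross_corr_def vanish by simp
qed

lemma integrable_cross_corr_square: "integrable lborel (\<lambda>x. (cmod (cross_corr T bump bump x))\<^sup>2)"
proof -
  obtain M where M: "\<And>x. cmod (cross_corr T bump bump x) \<le> M"
    using cross_corr_bounded by blast
  show ?thesis
  proof (rule integrable_lborel_bounded_support[where C = "M\<^sup>2" and S = "ball 0 (2 * \<epsilon>)"])
    show "norm ((cmod (cross_corr T bump bump x))\<^sup>2) \<le> M\<^sup>2" for x
      using power_mono[OF M norm_ge_zero] by simp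
    show "(\<lambda>x. (cmod (cross_corr T bump bump x))\<^sup>2) \<in> borel_measurable borel"
      by measurable
    show "(cmod (cross_corr T bump bump x))\<^sup>2 = 0" if "x \<notin> ball 0 (2 * \<epsilon>)" for x
      using cross_corr_eq_0[OF that] by simp
  qed (rule bounded_ball)
qed

lemma integrable_cross_corr_inner:
  assumes "continuous_on UNIV G" "\<And>x. cmod (G x) \<le> D"
  shows "integrable lborel (\<lambda>x. Re (cross_corr T bump bump x * cnj (G x)))"
proof -
  have [measurable]: "G \<in> borel_measurable borel"
    using assms(1) by (rule borel_measurable_continuous_onI)
  obtain M where M: "\<And>x. cmod (cross_corr T bump bump x) \<le> M"
    using cross_corr_bounded by blast
  have "norm (Re (cross_corr T bump bump x * cnj (G x))) \<le> M * D" for x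
  proof -
    have "norm (Re (cross_corr T bump bump x * cnj (G x))) \<le> cmod (cross_corr T bump bump x * cnj (G x))"
      using abs_Re_le_cmod by (simp del: times_complex.sel)
    also have "\<dots> \<le> M * D"
      using M[of x] assms(2)[of x] order_trans[OF norm_ge_zero M]
      by (simp add: norm_mult mult_mono)
    finally show ?thesis .
  qed
  then show ?thesis
  proof (rule integrable_lborel_bounded_support[where S = "ball 0 (2 * \<epsilon>)", rotated])
    show "(\<lambda>x. Re (cross_corr T bump bump x * cnj (G x))) \<in> borel_measurable borel"
      by measurable
    show "Re (cross_corr T bump bump x * cnj (G x)) = 0" if "x \<notin> ball 0 (2 * \<epsilon>)" for x
      using cross_corr_eq_0[OF that] by simp
  qed (rule bounded_ball)
qed

text \<open>
  The integrand of the correlation at \<open>x\<close> is supported on pairs \<open>v = x + y\<close>, \<open>w = y\<close> in the ball, and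
  \<open>x = v - w\<close>. Hence multiplying by \<open>cnj (G x)\<close> under the integral turns the inner product into a
  double integral of the kernel in the hypothesis, which is positive on an open set.
\<close>

lemma cross_corr_inner_pos:
  assumes "continuous_on UNIV G" "\<And>x. cmod (G x) \<le> D"
    and pos: "\<And>v w. v \<in> ball 0 \<epsilon> \<Longrightarrow> w \<in> ball 0 \<epsilon> \<Longrightarrow> 0 < Re (T v w * cnj (G (v - w)))"
  shows "0 < (\<integral>x. Re (cross_corr T bump bump x * cnj (G x)) \<partial>lborel)"
proof -
  let ?k = "\<lambda>x y. Re (cnj (bump y) * bump (x + y) * T (x + y) y * cnj (G x))"
  have int: "integrable lborel (?k x)" for x
    by (intro integrable_Re integrable_mult_left integrable_integrand)
  have eq: "Re (cross_corr T bump bump x * cnj (G x)) = (\<integral>y. ?k x y \<partial>lborel)" for x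
  proof -
    have "cross_corr T bump bump x * cnj (G x)
        = (\<integral>y. cnj (bump y) * bump (x + y) * T (x + y) y * cnj (G x) \<partial>lborel)"
      by (simp add: cross_corr_def)
    then show ?thesis
      using integral_Re[OF integrable_mult_left[OF integrable_integrand, of x "cnj (G x)"]] by metis
  qed
  have k_pos: "0 < ?k x y" if "y \<in> ball 0 \<epsilon>" "x + y \<in> ball 0 \<epsilon>" for x y
    using pos[OF that(2,1)] that by (simp add: indicator_def)
  have k_nonneg: "0 \<le> ?k x y" for x y
  proof (cases "y \<in> ball 0 \<epsilon> \<and> x + y \<in> ball 0 \<epsilon>")
    case True
    then show ?thesis using k_pos[of y x] by simp
  next
    case False
    then show ?thesis by (auto simp: indicator_def)
  qed
  have inner_pos: "0 < (\<integral>y. ?k x y \<partial>lborel)" if x: "x \<in> ball 0 \<epsilon>" for x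
  proof (rule integral_lborel_pos_if_pos_on_open[where U = "ball 0 \<epsilon> \<inter> ball (- x) \<epsilon>"])
    show "ball 0 \<epsilon> \<inter> ball (- x) \<epsilon> \<noteq> {}"
      using x radius_pos by (auto intro!: exI[of _ 0] simp: disjoint_iff)
    show "0 < ?k x y" if "y \<in> ball 0 \<epsilon> \<inter> ball (- x) \<epsilon>" for y
    proof (rule k_pos)
      have "dist (- x) y = norm (x + y)"
        by (metis dist_norm diff_minus_eq_add dist_commute add.commute)
      then show "x + y \<in> ball 0 \<epsilon>" using that by simp
    qed (use that in simp)
  qed (use int k_nonneg in auto)
  show ?thesis
  proof (rule integral_lborel_pos_if_pos_on_open[where U = "ball 0 \<epsilon>"])
    show "integrable lborel (\<lambda>x. Re (cross_corr T bump bump x * cnj (G x)))"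
      by (rule integrable_cross_corr_inner[OF assms(1,2)])
    show "0 \<le> Re (cross_corr T bump bump x * cnj (G x))" for x
      unfolding eq using k_nonneg by (rule Bochner_Integration.integral_nonneg)
    show "0 < Re (cross_corr T bump bump x * cnj (G x))" if "x \<in> ball 0 \<epsilon>" for x
      unfolding eq using that by (rule inner_pos)
    show "ball 0 \<epsilon> \<noteq> ({} :: (real^2) set)"
      using radius_pos by simp
  qed (rule open_ball)
qed

end

section \<open>Non-convexity\<close>

lemma not_convex_on_if_center_max:
  assumes "x \<in> S" "- x \<in> S" "F x < F 0" "F (- x) < F 0"
  shows "\<not> convex_on S (F :: 'a::real_vector \<Rightarrow> real)"
proof
  assume "convex_on S F"
  from convex_onD[OF this, of "1/2" x "- x"] assms
  have "F 0 \<le> 1/2 * F x + 1/2 * F (- x)"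
    by simp
  with assms show False by simp
qed

theorem proposition3p5:
  fixes lam Cs \<alpha>max :: real
    and s :: "real^2 \<Rightarrow> real" and f :: "real \<Rightarrow> real"
    and N :: nat and g :: "nat \<Rightarrow> real^2 \<Rightarrow> real" and Z :: "nat \<Rightarrow> real"
    and t :: "nat \<Rightarrow> real^2"
  assumes "lam > 0" and "\<alpha>max > 0"
    and "prob_density s" and "prob_density f"
    and "\<And>j. j \<in> {1..N} \<Longrightarrow> integrable lborel (g j)"
    and "\<And>j. j \<in> {1..N} \<Longrightarrow> integrable lborel (\<lambda>x. (g j x)\<^sup>2)"
    and "\<And>j. j \<in> {1..N} \<Longrightarrow> AE x in lborel. 0 \<le> g j x"
    and "\<And>j. j \<in> {1..N} \<Longrightarrow>
           supp (fourier (\<lambda>x. complex_of_real (g j x)))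
             \<subseteq> closure ((\<lambda>v. 2 *\<^sub>R v) ` aperture lam \<alpha>max)"
    and "\<exists>j\<in>{1..N}. \<not> (AE x in lborel. g j x = 0)"
  shows "\<not> convex_on (L2_on (aperture lam \<alpha>max)) (\<lambda>\<Psi>. E lam Cs \<alpha>max s f N g Z \<Psi> t)"
proof -
  have s: "integrable lborel s" and f: "integrable lborel f"
    using assms(3,4) by (auto simp: prob_density_def)
  define A where "A = aperture lam \<alpha>max"
  have A: "A = ball 0 (\<alpha>max / lam)"
    by (auto simp: A_def aperture_def)
  define G where "G j = fourier (\<lambda>y. complex_of_real ((g j \<circ> (\<lambda>x. x + t j)) y))" for j
  define K where "K j = tcc_kernel lam Cs s f (Z j)" for j
  define T where "T j = TCC lam Cs \<alpha>max s f (Z j)" for j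
  define P where "P = {j \<in> {1..N}. \<not> (AE x in lborel. g j x = 0)}"
  define D where "D j = (\<integral>y. cmod (complex_of_real ((g j \<circ> (\<lambda>x. x + t j)) y)) \<partial>lborel)" for j

  have shifted: "integrable lborel (\<lambda>y. complex_of_real ((g j \<circ> (\<lambda>x. x + t j)) y))"
    if "j \<in> {1..N}" for j
    using integrable_lborel_shift[OF assms(5)[OF that], of "t j"]
    by (intro integrable_of_real)
  have G_cont: "continuous_on UNIV (G j)" and G_bound: "cmod (G j x) \<le> D j"
    if "j \<in> {1..N}" for j x
    unfolding G_def D_def
    using continuous_on_fourier[OF shifted[OF that]] norm_fourier_le[OF shifted[OF that]] by auto
  have G_shift: "G j x = exp (2 * pi * \<i> * complex_of_real (x \<bullet> t j)) *
      fourier (\<lambda>x. complex_of_real (g j x)) x" if "j \<in> {1..N}" for j x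
    using fourier_shift[of "\<lambda>x. complex_of_real (g j x)" "t j" x] assms(5)[OF that]
    by (simp add: G_def o_def)

  \<comment> \<open>Square integrability: without it the norm in the functional would not split into the three
    parts of the quartic.\<close>
  have G_square: "integrable lborel (\<lambda>x. (cmod (G j x))\<^sup>2)" if j: "j \<in> {1..N}" for j
  proof (rule integrable_lborel_bounded_support[where C = "(D j)\<^sup>2" and S = "closure ((\<lambda>v. 2 *\<^sub>R v) ` A)"])
    show "(\<lambda>x. (cmod (G j x))\<^sup>2) \<in> borel_measurable borel"
      using G_cont[OF j] by (intro borel_measurable_continuous_onI continuous_intros)
    show "bounded (closure ((\<lambda>v. 2 *\<^sub>R v) ` A))"
      unfolding A by (intro bounded_closure bounded_scaling bounded_ball)
    fix x assume "x \<notin> closure ((\<lambda>v. 2 *\<^sub>R v) ` A)"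
    then have "x \<notin> supp (fourier (\<lambda>x. complex_of_real (g j x)))"
      using assms(8)[OF j] A_def by auto
    then have "fourier (\<lambda>x. complex_of_real (g j x)) x = 0"
      using closure_subset[of "{x. fourier (\<lambda>x. complex_of_real (g j x)) x \<noteq> 0}"]
      by (auto simp: supp_def)
    then show "(cmod (G j x))\<^sup>2 = 0"
      by (simp add: G_shift[OF j])
  qed (use G_bound[OF j] in \<open>auto intro: power_mono\<close>)

  have G_null: "G j x = 0" if j: "j \<in> {1..N}" "j \<notin> P" for j x
  proof -
    have "AE y in lborel. complex_of_real (g j y) * exp (- (2 * pi * \<i> * complex_of_real (x \<bullet> y))) = 0"
      using j by (auto simp: P_def)
    then have "fourier (\<lambda>x. complex_of_real (g j x)) x = 0"
      unfolding fourier_def by (rule integral_eq_zero_AE)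
    then show ?thesis by (simp add: G_shift[OF j(1)])
  qed

  have G_0: "G j 0 = complex_of_real (\<integral>x. g j x \<partial>lborel)" if "j \<in> {1..N}" for j
    using G_shift[OF that, of 0] by (simp add: fourier_def)
  have g_pos: "0 < (\<integral>x. g j x \<partial>lborel)" if j: "j \<in> P" for j
  proof -
    have "0 \<le> (\<integral>x. g j x \<partial>lborel)"
      using j assms(7) by (auto simp: P_def intro: integral_nonneg_AE)
    moreover have "(\<integral>x. g j x \<partial>lborel) \<noteq> 0"
      using j assms(5,7) by (auto simp: P_def integral_nonneg_eq_0_iff_AE)
    ultimately show ?thesis by simp
  qed

  \<comment> \<open>The kernel without cut-off is used here, because its continuity gives positivity of the real part
    near the origin for each of the finitely many nonzero images.\<close>
  have "\<forall>\<^sub>F p in nhds (0, 0). \<forall>j\<in>P. 0 < Re (K j (fst p) (snd p) * cnj (G j (fst p - snd p)))"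
  proof (rule eventually_ball_finite)
    show "finite P" by (simp add: P_def)
    show "\<forall>j\<in>P. \<forall>\<^sub>F p in nhds (0, 0). 0 < Re (K j (fst p) (snd p) * cnj (G j (fst p - snd p)))"
    proof
      fix j assume j: "j \<in> P"
      then have jN: "j \<in> {1..N}" by (simp add: P_def)
      have "continuous_on UNIV (\<lambda>p. K j (fst p) (snd p))"
        using continuous_on_tcc_kernel[OF s f, of lam Cs "Z j"] by (simp add: K_def case_prod_beta)
      moreover have "continuous_on UNIV (\<lambda>p :: (real^2) \<times> (real^2). G j (fst p - snd p))"
        by (rule continuous_on_compose2[OF G_cont[OF jN]]) (auto intro!: continuous_intros)
      ultimately have "continuous_on UNIV (\<lambda>p. Re (K j (fst p) (snd p) * cnj (G j (fst p - snd p))))"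
        by (intro continuous_intros)
      then have "isCont (\<lambda>p. Re (K j (fst p) (snd p) * cnj (G j (fst p - snd p)))) (0, 0)"
        by (simp add: continuous_on_eq_continuous_at)
      then have "((\<lambda>p. Re (K j (fst p) (snd p) * cnj (G j (fst p - snd p)))) \<longlongrightarrow>
          Re (K j 0 0 * cnj (G j 0))) (nhds (0, 0))"
        by (simp add: continuous_at tendsto_nhds_iff del: times_complex.sel)
      moreover have "0 < Re (K j 0 0 * cnj (G j 0))"
        using g_pos[OF j] by (simp add: K_def tcc_kernel_diagonal[OF assms(3,4)] G_0[OF jN])
      ultimately show "\<forall>\<^sub>F p in nhds (0, 0). 0 < Re (K j (fst p) (snd p) * cnj (G j (fst p - snd p)))"
        by (rule order_tendstoD)
    qed
  qed
  then obtain \<delta> where \<delta>: "\<delta> > 0" "\<And>p j. dist p (0, 0) < \<delta> \<Longrightarrow> j \<in> P \<Longrightarrow>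
      0 < Re (K j (fst p) (snd p) * cnj (G j (fst p - snd p)))"
    by (auto simp: eventually_nhds_metric)
  \<comment> \<open>Half of \<open>\<delta>\<close>, so that two points of the ball form a pair of norm less than \<open>\<delta>\<close>; and small enough
    for the ball to lie in the aperture.\<close>
  define \<epsilon> where "\<epsilon> = min (\<delta> / 2) (\<alpha>max / lam)"
  have \<epsilon>: "\<epsilon> > 0" using \<delta> assms(1,2) by (simp add: \<epsilon>_def)
  have ball_A: "ball 0 \<epsilon> \<subseteq> A" by (auto simp: A \<epsilon>_def)

  have corr: "bump_correlation (T j) ((\<integral>u. \<bar>s u\<bar> \<partial>lborel) * (\<integral>Z'. \<bar>f Z'\<bar> \<partial>lborel)) \<epsilon>" for j
  proof
    have [measurable]: "A \<in> sets borel" by (simp add: A)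
    have [measurable]: "(\<lambda>p. K j (fst p) (snd p)) \<in> borel_measurable (borel \<Otimes>\<^sub>M borel)"
      using continuous_on_tcc_kernel[OF s f, of lam Cs "Z j"] unfolding borel_prod
      by (intro borel_measurable_continuous_onI) (simp add: K_def case_prod_beta)
    have "(\<lambda>p. indicator A (fst p) * indicator A (snd p) * K j (fst p) (snd p))
        \<in> borel_measurable (borel \<Otimes>\<^sub>M borel)"
      by measurable
    then show "(\<lambda>(v, w). T j v w) \<in> borel_measurable borel"
      by (simp add: T_def K_def A_def TCC_eq_tcc_kernel case_prod_beta borel_prod)
    show "cmod (T j v w) \<le> (\<integral>u. \<bar>s u\<bar> \<partial>lborel) * (\<integral>Z'. \<bar>f Z'\<bar> \<partial>lborel)" for v w
      using cmod_tcc_kernel_le[OF s f, of lam Cs "Z j" v w]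
        order_trans[OF norm_ge_zero cmod_tcc_kernel_le[OF s f, of lam Cs "Z j" v w]]
      by (auto simp: T_def TCC_eq_tcc_kernel norm_mult indicator_def)
  qed (rule \<epsilon>)

  define \<Psi> :: "real^2 \<Rightarrow> complex" where "\<Psi> = indicator (ball 0 \<epsilon>)"
  define Q where "Q j = cross_corr (T j) \<Psi> \<Psi>" for j
  define b where "b j = (\<integral>x. Re (Q j x * cnj (G j x)) \<partial>lborel)" for j

  have b_pos: "0 < b j" if j: "j \<in> P" for j
    unfolding b_def Q_def \<Psi>_def
  proof (rule bump_correlation.cross_corr_inner_pos[OF corr])
    have jN: "j \<in> {1..N}" using j by (simp add: P_def)
    show "continuous_on UNIV (G j)" "cmod (G j x) \<le> D j" for x
      using G_cont[OF jN] G_bound[OF jN] by auto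
    fix v w :: "real^2" assume vw: "v \<in> ball 0 \<epsilon>" "w \<in> ball 0 \<epsilon>"
    have "norm (v, w) \<le> norm v + norm w"
      using norm_Pair_le by blast
    also have "\<dots> < \<delta>" using vw by (auto simp: \<epsilon>_def)
    finally have "0 < Re (K j v w * cnj (G j (v - w)))"
      using \<delta>(2)[of "(v, w)" j] j by (simp add: dist_norm)
    moreover have "T j v w = K j v w"
      using subsetD[OF ball_A vw(1)] subsetD[OF ball_A vw(2)]
      by (simp add: T_def K_def TCC_eq_tcc_kernel A_def)
    ultimately show "0 < Re (T j v w * cnj (G j (v - w)))" by simp
  qed
  have b_zero: "b j = 0" if "j \<in> {1..N}" "j \<notin> P" for j
    using G_null[OF that] by (simp add: b_def)
  define B where "B = (\<Sum>j=1..N. b j)"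
  have "0 < B"
  proof -
    obtain i where i: "i \<in> P" using assms(9) by (auto simp: P_def)
    have "0 \<le> b j" if "j \<in> {1..N}" for j
      using b_pos[of j] b_zero[OF that] by (cases "j \<in> P") auto
    then show ?thesis
      unfolding B_def using i b_pos[OF i] by (intro sum_pos2[of _ i]) (auto simp: P_def)
  qed
  define a where "a = (\<Sum>j=1..N. (L2_norm (Q j))\<^sup>2)"
  define c where "c = (\<Sum>j=1..N. (L2_norm (G j))\<^sup>2)"
  have a: "0 \<le> a" by (simp add: a_def sum_nonneg)

  have E: "E lam Cs \<alpha>max s f N g Z (r *\<^sub>R \<Psi>) t = 1 / real N * ((r\<^sup>2)\<^sup>2 * a - 2 * r\<^sup>2 * B + c)" for r
  proof -
    have "(L2_norm (\<lambda>x. cross_corr (T j) (r *\<^sub>R \<Psi>) (r *\<^sub>R \<Psi>) x - G j x))\<^sup>2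
        = (r\<^sup>2)\<^sup>2 * (L2_norm (Q j))\<^sup>2 - 2 * r\<^sup>2 * b j + (L2_norm (G j))\<^sup>2" if j: "j \<in> {1..N}" for j
      unfolding cross_corr_scaleR b_def Q_def \<Psi>_def
      by (intro L2_norm_diff_square G_square j
          bump_correlation.integrable_cross_corr_square[OF corr]
          bump_correlation.integrable_cross_corr_inner[OF corr G_cont[OF j] G_bound[OF j]])
    then show ?thesis
      unfolding E_def T_def[symmetric] G_def[symmetric]
      by (simp add: a_def B_def c_def sum.distrib sum_subtractf sum_distrib_left)
  qed

  \<comment> \<open>The quartic is \<open>r^2 (r^2 a - 2 B) + c\<close>; this choice makes \<open>r^2 a \<le> B\<close>, and adding one to \<open>a\<close> covers
    the case \<open>a = 0\<close>.\<close>
  define r where "r = sqrt (B / (a + 1))"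
  have r: "r\<^sup>2 = B / (a + 1)" using \<open>0 < B\<close> a by (simp add: r_def)
  have less: "(r\<^sup>2)\<^sup>2 * a - 2 * r\<^sup>2 * B < 0"
  proof -
    have "r\<^sup>2 * a \<le> B"
      unfolding r using \<open>0 < B\<close> a by (simp add: field_simps)
    then have "r\<^sup>2 * a - 2 * B < 0"
      using \<open>0 < B\<close> by simp
    moreover have "0 < r\<^sup>2" unfolding r using \<open>0 < B\<close> a by simp
    ultimately have "r\<^sup>2 * (r\<^sup>2 * a - 2 * B) < 0" by (simp add: mult_pos_neg)
    then show ?thesis by (simp add: algebra_simps power2_eq_square)
  qed
  have N: "0 < N" using assms(9) by auto
  have scale_in: "k *\<^sub>R \<Psi> \<in> L2_on A" for k
  proof -
    have "integrable lborel (\<lambda>v. (cmod (k *\<^sub>R \<Psi> v))\<^sup>2)"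
      by (rule integrable_lborel_bounded_support[where C = "k\<^sup>2" and S = "ball 0 \<epsilon>"])
         (auto simp: \<Psi>_def indicator_def)
    then show ?thesis
      using ball_A by (auto simp: L2_on_def \<Psi>_def scaleR_fun_def indicator_def)
  qed
  have lower: "E lam Cs \<alpha>max s f N g Z (k *\<^sub>R \<Psi>) t < E lam Cs \<alpha>max s f N g Z 0 t" if "k\<^sup>2 = r\<^sup>2" for k
    using E[of k] E[of 0] less N that by (simp add: divide_strict_right_mono)
  show ?thesis
    using not_convex_on_if_center_max[of "r *\<^sub>R \<Psi>" "L2_on A" "\<lambda>\<Psi>. E lam Cs \<alpha>max s f N g Z \<Psi> t"]
      scale_in[of r] scale_in[of "- r"] lower[of r] lower[of "- r"]
    by (simp add: A_def)
qed

end
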